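(* Let $M$ be a reduced root-closed Cale monoid with basis $Q$. Then $M$ is isomorphic to $\mathrm{Ap}(M,Q)\times\langle Q\rangle$ endowed with the operation $$(a,f)+(b,g)=(a\oplus b,\ f+g+\mathrm{I}(a,b)).$$
   Context: Monoids are commutative, cancellative and written additively; $\mathbb{N}=\{0,1,2,\dots\}$. A monoid $M$ is reduced if its only unit is $0$. $\langle Q\rangle$ denotes the submonoid generated by $Q$. A reduced monoid $M$ is inside factorial with base (Cale basis) $Q$, where $Q$ is a set of nonzero elements of $M$, if (i) for each $x\in M$ there is a positive integer $n(x)$ with $n(x)x\in\langle Q\rangle$, and (ii) whenever $\sum_{q\in Q}\lambda_q q=\sum_{q\in Q}\mu_q q$ with $\lambda_q,\mu_q\in\mathbb{N}$, all but finitely many zero, then $\lambda_q=\mu_q$ for all $q\in Q$. Let $\mathrm{G}(M)$ be the quotient group of $M$. $M$ is root-closed if whenever $nz\in M$ for some positive integer $n$ and some $z\in\mathrm{G}(M)$, then $z\in M$. Write $a\le_M b$ if $a+c=b$ for some $c\in M$, and $\lambda(x,y)=\sup\{m/n \mid m\in\mathbb{N},\ n\in\mathbb{Z}^+,\ mx\le_M ny\}$. A Cale base $Q$ is tame if for every $q\in Q$ there is a positive integer $\ell(q)$ with $\ell(q)\lambda(q,x)\in\mathbb{N}$ for all $x\in M$. A Cale monoid is an inside factorial monoid with a tame base. The Apéry set is $\mathrm{Ap}(M,Q)=M\setminus(Q+M)$. For $M$ reduced, root-closed and inside factorial with base $Q$, every element of $M$ can be written uniquely as $c+f$ with $c\in\mathrm{Ap}(M,Q)$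 and $f\in\langle Q\rangle$. For $a,b\in\mathrm{Ap}(M,Q)$, write $a+b=c+f$ in this way and set $a\oplus b=c$ and $\mathrm{I}(a,b)=f$. *)

theory Defs
  imports "HOL-Algebra.Divisibility" "HOL-Algebra.FiniteProduct" "HOL-Library.Extended_Real"
begin

text \<open>
  A monoid is a \<open>comm_monoid_cancel\<close> in the multiplicative notation of HOL-Algebra. Compared with
  additive notation, \<open>a + b\<close> is \<open>a \<otimes>\<^bsub>M\<^esub> b\<close>, \<open>0\<close> is \<open>\<one>\<^bsub>M\<^esub>\<close>, the multiple \<open>n x\<close> is \<open>x [^]\<^bsub>M\<^esub> n\<close>,
  and \<open>a \<le>\<^sub>M b\<close> is \<open>a divides\<^bsub>M\<^esub> b\<close>.
\<close>

definition reduced :: "('a, 'b) monoid_scheme \<Rightarrow> bool" where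
  "reduced M \<longleftrightarrow> Units M = {\<one>\<^bsub>M\<^esub>}"

definition gen_submonoid :: "('a, 'b) monoid_scheme \<Rightarrow> 'a set \<Rightarrow> 'a set" where
  "gen_submonoid M Q = (\<lambda>H. submonoid H M) hull Q"


section \<open>The quotient group and root-closed monoids\<close>

text \<open>The class of \<open>(a, b)\<close> is the formal difference \<open>a - b\<close>.\<close>

definition diff_rel :: "('a, 'b) monoid_scheme \<Rightarrow> (('a \<times> 'a) \<times> ('a \<times> 'a)) set" where
  "diff_rel M = {((a, b), (c, d)) | a b c d. a \<in> carrier M \<and> b \<in> carrier M \<and>
     c \<in> carrier M \<and> d \<in> carrier M \<and> a \<otimes>\<^bsub>M\<^esub> d = c \<otimes>\<^bsub>M\<^esub> b}"

definition quotient_group :: "('a, 'b) monoid_scheme \<Rightarrow> ('a \<times> 'a) set monoid" where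
  "quotient_group M =
     \<lparr>carrier = carrier (M \<times>\<times> M) // diff_rel M,
      mult = (\<lambda>X Y. \<Union>x\<in>X. \<Union>y\<in>Y. diff_rel M `` {x \<otimes>\<^bsub>M \<times>\<times> M\<^esub> y}),
      one = diff_rel M `` {(\<one>\<^bsub>M\<^esub>, \<one>\<^bsub>M\<^esub>)}\<rparr>"

definition quotient_embed :: "('a, 'b) monoid_scheme \<Rightarrow> 'a \<Rightarrow> ('a \<times> 'a) set" where
  "quotient_embed M x = diff_rel M `` {(x, \<one>\<^bsub>M\<^esub>)}"

definition root_closed :: "('a, 'b) monoid_scheme \<Rightarrow> bool" where
  "root_closed M \<longleftrightarrow>
     (\<forall>z \<in> carrier (quotient_group M). \<forall>n::nat. n > 0 \<longrightarrow>
        z [^]\<^bsub>quotient_group M\<^esub> n \<in> quotient_embed M ` carrier M \<longrightarrow>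
        z \<in> quotient_embed M ` carrier M)"

context comm_monoid_cancel
begin

lemma equiv_diff_rel: "equiv (carrier (G \<times>\<times> G)) (diff_rel G)"
proof (rule equivI)
  show "diff_rel G \<subseteq> carrier (G \<times>\<times> G) \<times> carrier (G \<times>\<times> G)"
    by (auto simp: diff_rel_def)
  show "refl_on (carrier (G \<times>\<times> G)) (diff_rel G)"
    by (auto simp: refl_on_def diff_rel_def)
  show "sym (diff_rel G)"
    by (auto simp: sym_def diff_rel_def)
  show "trans (diff_rel G)"
  proof (rule transI)
    fix x y z
    assume "(x, y) \<in> diff_rel G" "(y, z) \<in> diff_rel G"
    then obtain a b c d e f where eq: "x = (a, b)" "y = (c, d)" "z = (e, f)"
      and car: "a \<in> carrier G" "b \<in> carrier G" "c \<in> carrier G" "d \<in> carrier G"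
        "e \<in> carrier G" "f \<in> carrier G"
      and h: "a \<otimes> d = c \<otimes> b" "c \<otimes> f = e \<otimes> d"
      by (auto simp: diff_rel_def)
    have "(a \<otimes> f) \<otimes> d = (a \<otimes> d) \<otimes> f" using car by (simp add: m_ac)
    also have "\<dots> = (c \<otimes> f) \<otimes> b" using car by (simp add: h(1) m_ac)
    also have "\<dots> = (e \<otimes> b) \<otimes> d" unfolding h(2) using car by (simp add: m_ac)
    finally have "a \<otimes> f = e \<otimes> b" using car by (meson m_closed r_cancel)
    then show "(x, z) \<in> diff_rel G" using car eq by (auto simp: diff_rel_def)
  qed
qed

lemma diff_rel_class_eq:
  assumes "a \<in> carrier G" "b \<in> carrier G" "c \<in> carrier G" "d \<in> carrier G"
  shows "diff_rel G `` {(a, b)} = diff_rel G `` {(c, d)} \<longleftrightarrow> a \<otimes> d = c \<otimes> b"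
  using eq_equiv_class_iff[OF equiv_diff_rel, of "(a, b)" "(c, d)"] assms
  by (auto simp: diff_rel_def)

lemma quotient_group_carrierE:
  assumes "z \<in> carrier (quotient_group G)"
  obtains a b where "a \<in> carrier G" "b \<in> carrier G" "z = diff_rel G `` {(a, b)}"
  using assms by (auto simp: quotient_group_def elim!: quotientE)

lemma quotient_group_carrierI:
  assumes "a \<in> carrier G" "b \<in> carrier G"
  shows "diff_rel G `` {(a, b)} \<in> carrier (quotient_group G)"
  using assms by (auto simp: quotient_group_def intro!: quotientI)

lemma diff_rel_mult_cong:
  assumes "(x, x') \<in> diff_rel G" "(y, y') \<in> diff_rel G"
  shows "(x \<otimes>\<^bsub>G \<times>\<times> G\<^esub> y, x' \<otimes>\<^bsub>G \<times>\<times> G\<^esub> y') \<in> diff_rel G"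
proof -
  obtain a b a' b' where x: "x = (a, b)" "x' = (a', b')" "a \<in> carrier G" "b \<in> carrier G"
      "a' \<in> carrier G" "b' \<in> carrier G" "a \<otimes> b' = a' \<otimes> b"
    using assms(1) by (auto simp: diff_rel_def)
  obtain c d c' d' where y: "y = (c, d)" "y' = (c', d')" "c \<in> carrier G" "d \<in> carrier G"
      "c' \<in> carrier G" "d' \<in> carrier G" "c \<otimes> d' = c' \<otimes> d"
    using assms(2) by (auto simp: diff_rel_def)
  have "(a \<otimes> c) \<otimes> (b' \<otimes> d') = (a \<otimes> b') \<otimes> (c \<otimes> d')"
    using x(3-6) y(3-6) by (simp add: m_ac)
  also have "\<dots> = (a' \<otimes> c') \<otimes> (b \<otimes> d)"
    unfolding x(7) y(7) using x(3-6) y(3-6) by (simp add: m_ac)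
  finally show ?thesis using x y by (auto simp: diff_rel_def)
qed

lemma quotient_group_mult:
  assumes "a \<in> carrier G" "b \<in> carrier G" "c \<in> carrier G" "d \<in> carrier G"
  shows "diff_rel G `` {(a, b)} \<otimes>\<^bsub>quotient_group G\<^esub> diff_rel G `` {(c, d)} =
         diff_rel G `` {(a \<otimes> c, b \<otimes> d)}"
proof -
  have "congruent2 (diff_rel G) (diff_rel G) (\<lambda>x y. diff_rel G `` {x \<otimes>\<^bsub>G \<times>\<times> G\<^esub> y})"
    by (rule congruent2I')
      (meson diff_rel_mult_cong equiv_class_eq[OF equiv_diff_rel])
  from UN_equiv_class2[OF equiv_diff_rel equiv_diff_rel this, of "(a, b)" "(c, d)"]
  show ?thesis using assms by (simp add: quotient_group_def)
qed

lemma comm_group_quotient_group: "comm_group (quotient_group G)"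
proof (rule comm_groupI)
  let ?Q = "quotient_group G"
  have one: "\<one>\<^bsub>?Q\<^esub> = diff_rel G `` {(\<one>, \<one>)}" by (simp add: quotient_group_def)
  show "\<one>\<^bsub>?Q\<^esub> \<in> carrier ?Q" unfolding one by (simp add: quotient_group_carrierI)
  show "x \<otimes>\<^bsub>?Q\<^esub> y \<in> carrier ?Q" if "x \<in> carrier ?Q" "y \<in> carrier ?Q" for x y
    using that by (auto elim!: quotient_group_carrierE
        simp: quotient_group_mult quotient_group_carrierI)
  show "x \<otimes>\<^bsub>?Q\<^esub> y \<otimes>\<^bsub>?Q\<^esub> z = x \<otimes>\<^bsub>?Q\<^esub> (y \<otimes>\<^bsub>?Q\<^esub> z)"
    if "x \<in> carrier ?Q" "y \<in> carrier ?Q" "z \<in> carrier ?Q" for x y z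
    using that by (auto elim!: quotient_group_carrierE simp: quotient_group_mult m_assoc)
  show "x \<otimes>\<^bsub>?Q\<^esub> y = y \<otimes>\<^bsub>?Q\<^esub> x" if "x \<in> carrier ?Q" "y \<in> carrier ?Q" for x y
    using that by (auto elim!: quotient_group_carrierE simp: quotient_group_mult m_comm)
  show "\<one>\<^bsub>?Q\<^esub> \<otimes>\<^bsub>?Q\<^esub> x = x" if "x \<in> carrier ?Q" for x
    using that by (auto elim!: quotient_group_carrierE simp: one quotient_group_mult)
  show "\<exists>y\<in>carrier ?Q. y \<otimes>\<^bsub>?Q\<^esub> x = \<one>\<^bsub>?Q\<^esub>" if "x \<in> carrier ?Q" for x
  proof -
    from that obtain a b where x: "a \<in> carrier G" "b \<in> carrier G" "x = diff_rel G `` {(a, b)}"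
      by (rule quotient_group_carrierE)
    then have "diff_rel G `` {(b, a)} \<otimes>\<^bsub>?Q\<^esub> x = \<one>\<^bsub>?Q\<^esub>"
      by (simp add: quotient_group_mult one diff_rel_class_eq m_comm)
    then show ?thesis using x quotient_group_carrierI by blast
  qed
qed

lemma quotient_embed_hom: "quotient_embed G \<in> hom G (quotient_group G)"
  by (auto intro!: homI simp: quotient_embed_def quotient_group_mult quotient_group_carrierI)

lemma inj_on_quotient_embed: "inj_on (quotient_embed G) (carrier G)"
  by (auto intro!: inj_onI simp: quotient_embed_def diff_rel_class_eq)

lemma quotient_group_eq_diff:
  assumes "z \<in> carrier (quotient_group G)"
  shows "\<exists>a\<in>carrier G. \<exists>b\<in>carrier G. z =
    quotient_embed G a \<otimes>\<^bsub>quotient_group G\<^esub> inv\<^bsub>quotient_group G\<^esub> quotient_embed G b"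
proof -
  interpret Q: comm_group "quotient_group G" by (rule comm_group_quotient_group)
  from assms obtain a b where z: "a \<in> carrier G" "b \<in> carrier G" "z = diff_rel G `` {(a, b)}"
    by (rule quotient_group_carrierE)
  have b: "quotient_embed G b \<in> carrier (quotient_group G)"
    using z by (simp add: quotient_embed_def quotient_group_carrierI)
  have "z \<otimes>\<^bsub>quotient_group G\<^esub> quotient_embed G b = quotient_embed G a"
    using z by (simp add: quotient_embed_def quotient_group_mult diff_rel_class_eq m_ac)
  then have "z = quotient_embed G a \<otimes>\<^bsub>quotient_group G\<^esub> inv\<^bsub>quotient_group G\<^esub> quotient_embed G b"
    using Q.inv_solve_right'[of "quotient_embed G a" z "quotient_embed G b"] assms b
    by (metis Q.m_closed Q.inv_solve_right)
  then show ?thesis using z by blast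
qed

end


section \<open>Inside factorial monoids and Cale monoids\<close>

text \<open>
  A family of coefficients is a function \<open>c\<close>, of which only the values on \<open>Q\<close> matter. The product
  is restricted to the support of \<open>c\<close> because \<open>finprod\<close> over an infinite set is the neutral element.
\<close>

definition lin_comb :: "('a, 'b) monoid_scheme \<Rightarrow> 'a set \<Rightarrow> ('a \<Rightarrow> nat) \<Rightarrow> 'a" where
  "lin_comb M Q c = finprod M (\<lambda>q. q [^]\<^bsub>M\<^esub> c q) {q \<in> Q. c q \<noteq> 0}"

definition inside_factorial :: "('a, 'b) monoid_scheme \<Rightarrow> 'a set \<Rightarrow> bool" where
  "inside_factorial M Q \<longleftrightarrow>
     Q \<subseteq> carrier M - {\<one>\<^bsub>M\<^esub>} \<and>
     (\<forall>x \<in> carrier M. \<exists>n::nat. n > 0 \<and> x [^]\<^bsub>M\<^esub> n \<in> gen_submonoid M Q) \<and>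
     (\<forall>c d. finite {q \<in> Q. c q \<noteq> 0} \<longrightarrow> finite {q \<in> Q. d q \<noteq> 0} \<longrightarrow>
        lin_comb M Q c = lin_comb M Q d \<longrightarrow> (\<forall>q \<in> Q. c q = d q))"

text \<open>
  The supremum is taken in the extended reals, since it may be infinite (for instance if \<open>x\<close> is the
  neutral element).
\<close>

definition lam :: "('a, 'b) monoid_scheme \<Rightarrow> 'a \<Rightarrow> 'a \<Rightarrow> ereal" where
  "lam M x y = Sup {ereal (real m / real n) | m n :: nat.
     n > 0 \<and> (x [^]\<^bsub>M\<^esub> m) divides\<^bsub>M\<^esub> (y [^]\<^bsub>M\<^esub> n)}"

definition tame :: "('a, 'b) monoid_scheme \<Rightarrow> 'a set \<Rightarrow> bool" where
  "tame M Q \<longleftrightarrow>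
     (\<forall>q \<in> Q. \<exists>l::nat. l > 0 \<and>
        (\<forall>x \<in> carrier M. \<exists>k::nat. ereal (real l) * lam M q x = ereal (real k)))"

definition cale_monoid :: "('a, 'b) monoid_scheme \<Rightarrow> 'a set \<Rightarrow> bool" where
  "cale_monoid M Q \<longleftrightarrow> inside_factorial M Q \<and> tame M Q"


section \<open>The Apery set and the twisted product\<close>

definition Ap :: "('a, 'b) monoid_scheme \<Rightarrow> 'a set \<Rightarrow> 'a set" where
  "Ap M Q = carrier M - (Q <#>\<^bsub>M\<^esub> carrier M)"

text \<open>
  For \<open>M\<close> reduced, root-closed and inside factorial with base \<open>Q\<close>, every element is the product of
  a unique element of \<open>Ap M Q\<close> and a unique element of \<open>gen_submonoid M Q\<close>. The definite descriptions
  below are only meaningful under such hypotheses.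
\<close>

definition Ap_sum :: "('a, 'b) monoid_scheme \<Rightarrow> 'a set \<Rightarrow> 'a \<Rightarrow> 'a \<Rightarrow> 'a" where
  "Ap_sum M Q a b =
     (THE c. c \<in> Ap M Q \<and> (\<exists>f \<in> gen_submonoid M Q. a \<otimes>\<^bsub>M\<^esub> b = c \<otimes>\<^bsub>M\<^esub> f))"

definition Ap_I :: "('a, 'b) monoid_scheme \<Rightarrow> 'a set \<Rightarrow> 'a \<Rightarrow> 'a \<Rightarrow> 'a" where
  "Ap_I M Q a b =
     (THE f. f \<in> gen_submonoid M Q \<and> (\<exists>c \<in> Ap M Q. a \<otimes>\<^bsub>M\<^esub> b = c \<otimes>\<^bsub>M\<^esub> f))"

definition Ap_product :: "('a, 'b) monoid_scheme \<Rightarrow> 'a set \<Rightarrow> ('a \<times> 'a) monoid" where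
  "Ap_product M Q =
     \<lparr>carrier = Ap M Q \<times> gen_submonoid M Q,
      mult = (\<lambda>(a, f) (b, g). (Ap_sum M Q a b, f \<otimes>\<^bsub>M\<^esub> g \<otimes>\<^bsub>M\<^esub> Ap_I M Q a b)),
      one = (\<one>\<^bsub>M\<^esub>, \<one>\<^bsub>M\<^esub>)\<rparr>"

end

theory Submission
  imports Defs
begin

text \<open>
  Write \<open>v\<^sub>q(x) = c q / n\<close> whenever \<open>x [^] n\<close>, with \<open>n > 0\<close>, is the product of the powers
  \<open>q [^] c q\<close>. In an inside factorial monoid every \<open>x\<close> has such a power, uniqueness of coefficients
  makes \<open>v\<^sub>q(x)\<close> independent of \<open>n\<close>, and \<open>v\<^sub>q\<close> turns products into sums. Root-closedness says that
  divisibility can be tested after taking a power: if \<open>a [^] n\<close> divides \<open>x [^] n\<close> then \<open>a\<close> divides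
  \<open>x\<close>. Hence \<open>q\<close> divides \<open>x\<close> exactly when \<open>v\<^sub>q(x) \<ge> 1\<close>, and the Apery set is the set of all \<open>x\<close>
  with \<open>v\<^sub>q(x) < 1\<close> for every \<open>q\<close> (lemma \<open>Ap_iff_coeff_less\<close>).

  So a factorization \<open>x = a \<otimes> f\<close> with \<open>a\<close> in the Apery set and \<open>f\<close> in the generated submonoid splits
  each \<open>v\<^sub>q(x)\<close> into a fractional part \<open>v\<^sub>q(a)\<close> and an integral part \<open>v\<^sub>q(f)\<close>. The integral parts
  determine \<open>f\<close>, and cancellation then gives \<open>a\<close>: this is uniqueness. Conversely, the product \<open>f\<close> of
  the powers of \<open>q\<close> to the integral part of \<open>v\<^sub>q(x)\<close> divides \<open>x\<close> by root-closedness, and the cofactor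
  lies in the Apery set: this is existence.

  Therefore \<open>(a, f) \<mapsto> a \<otimes> f\<close> is a bijection from the twisted product onto the monoid. The twist \<open>I\<close>
  is exactly what makes it multiplicative, so the twisted product inherits its laws from the monoid.
\<close>

section \<open>Linear combinations and the submonoid they form\<close>

abbreviation finite_support :: "'a set \<Rightarrow> ('a \<Rightarrow> nat) \<Rightarrow> bool" where
  "finite_support Q c \<equiv> finite {q \<in> Q. c q \<noteq> 0}"

lemma finite_support_add:
  assumes "finite_support Q c" "finite_support Q d"
  shows "finite_support Q (\<lambda>q. c q + d q)"
  by (rule finite_subset[OF _ finite_UnI[OF assms]]) auto

lemma finite_support_vanish:
  assumes "finite_support Q c" "\<And>q. c q = 0 \<Longrightarrow> d q = 0"
  shows "finite_support Q d"
proof -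
  have "c q \<noteq> 0" if "d q \<noteq> 0" for q
    using assms(2)[of q] that by (cases "c q = 0") simp_all
  then have "{q \<in> Q. d q \<noteq> 0} \<subseteq> {q \<in> Q. c q \<noteq> 0}"
    by auto
  then show ?thesis
    using assms(1) by (rule finite_subset)
qed

lemma finite_support_single: "finite_support Q (\<lambda>r. if r = q then n else 0)"
  by (rule finite_subset[of _ "{q}"]) auto

lemma submonoid_gen_submonoid:
  assumes "monoid M" "Q \<subseteq> carrier M"
  shows "submonoid (gen_submonoid M Q) M"
proof -
  interpret monoid M by fact
  have "submonoid (carrier M) M"
    by unfold_locales auto
  then show ?thesis
    using assms(2) unfolding gen_submonoid_def hull_def
    by unfold_locales (auto simp: submonoid.m_closed submonoid.one_closed)
qed

context comm_monoid_cancel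
begin

lemma lin_comb_closed: "Q \<subseteq> carrier G \<Longrightarrow> lin_comb G Q c \<in> carrier G"
  unfolding lin_comb_def by (rule finprod_closed) auto

text \<open>Combinations with different supports are compared over a common finite index set.\<close>

lemma lin_comb_over:
  assumes "Q \<subseteq> carrier G" "finite F" "F \<subseteq> Q" "\<And>q. q \<in> Q - F \<Longrightarrow> c q = 0"
  shows "lin_comb G Q c = finprod G (\<lambda>q. q [^] c q) F"
proof -
  have "q \<in> F" if "q \<in> Q" "c q \<noteq> 0" for q
    using assms(4)[of q] that by (cases "q \<in> F") simp_all
  then have "{q \<in> Q. c q \<noteq> 0} \<subseteq> F"
    by auto
  then show ?thesis
    unfolding lin_comb_def
    by (intro finprod_mono_neutral_cong_left) (use assms(1-3) in auto)
qed

lemma lin_comb_cong: "(\<And>q. q \<in> Q \<Longrightarrow> c q = d q) \<Longrightarrow> Q \<subseteq> carrier G \<Longrightarrow> lin_comb G Q c = lin_comb G Q d"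
  unfolding lin_comb_def by (rule finprod_cong') auto

lemma lin_comb_zero: "lin_comb G Q (\<lambda>q. 0) = \<one>"
  by (simp add: lin_comb_def)

lemma lin_comb_add:
  assumes Q: "Q \<subseteq> carrier G" and fin: "finite_support Q c" "finite_support Q d"
  shows "lin_comb G Q (\<lambda>q. c q + d q) = lin_comb G Q c \<otimes> lin_comb G Q d"
proof -
  define F where "F = {q \<in> Q. c q \<noteq> 0} \<union> {q \<in> Q. d q \<noteq> 0}"
  have F: "finite F" "F \<subseteq> Q" using fin by (auto simp: F_def)
  have "lin_comb G Q (\<lambda>q. c q + d q) = finprod G (\<lambda>q. q [^] (c q + d q)) F"
    by (rule lin_comb_over[OF Q F]) (auto simp: F_def)
  also have "\<dots> = finprod G (\<lambda>q. q [^] c q \<otimes> q [^] d q) F"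
    by (rule finprod_cong') (use Q F in \<open>auto simp: nat_pow_mult\<close>)
  also have "\<dots> = finprod G (\<lambda>q. q [^] c q) F \<otimes> finprod G (\<lambda>q. q [^] d q) F"
    by (rule finprod_multf) (use Q F in auto)
  also have "finprod G (\<lambda>q. q [^] c q) F = lin_comb G Q c"
    by (rule lin_comb_over[OF Q F, symmetric]) (auto simp: F_def)
  also have "finprod G (\<lambda>q. q [^] d q) F = lin_comb G Q d"
    by (rule lin_comb_over[OF Q F, symmetric]) (auto simp: F_def)
  finally show ?thesis .
qed

lemma lin_comb_mult:
  assumes "Q \<subseteq> carrier G" "finite_support Q c"
  shows "lin_comb G Q (\<lambda>q. n * c q) = lin_comb G Q c [^] (n::nat)"
proof (induction n)
  case 0
  show ?case by (simp add: lin_comb_zero)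
next
  case (Suc n)
  have "finite_support Q (\<lambda>q. n * c q)"
    by (rule finite_support_vanish[OF assms(2)]) simp
  then show ?case
    using lin_comb_add[OF assms(1), of "\<lambda>q. n * c q" c] assms(2) Suc.IH
    by (simp add: add.commute)
qed

lemma lin_comb_single:
  assumes "Q \<subseteq> carrier G" "q \<in> Q"
  shows "lin_comb G Q (\<lambda>r. if r = q then n else 0) = q [^] n"
  using lin_comb_over[OF assms(1), of "{q}" "\<lambda>r. if r = q then n else 0"] assms
  by (auto simp: finprod_insert)

lemma gen_submonoid_eq:
  assumes Q: "Q \<subseteq> carrier G"
  shows "gen_submonoid G Q = {lin_comb G Q c | c. finite_support Q c}" (is "_ = ?L")
proof
  have "submonoid ?L G"
  proof
    show "?L \<subseteq> carrier G" using lin_comb_closed[OF Q] by auto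
    show "\<one> \<in> ?L"
      by (rule CollectI, rule exI[of _ "\<lambda>q. 0"]) (simp add: lin_comb_zero)
    show "x \<otimes> y \<in> ?L" if "x \<in> ?L" "y \<in> ?L" for x y
      using that lin_comb_add[OF Q, symmetric] finite_support_add by fastforce
  qed
  moreover have "Q \<subseteq> ?L"
  proof
    fix q assume "q \<in> Q"
    then have "q = lin_comb G Q (\<lambda>r. if r = q then 1 else 0)"
      using lin_comb_single[OF Q, of q 1] Q by auto
    then show "q \<in> ?L"
      by (intro CollectI exI[of _ "\<lambda>r. if r = q then 1 else 0"] conjI finite_support_single)
  qed
  ultimately show "gen_submonoid G Q \<subseteq> ?L"
    unfolding gen_submonoid_def by (simp add: hull_minimal)
next
  interpret H: submonoid "gen_submonoid G Q" G
    by (rule submonoid_gen_submonoid[OF monoid_axioms Q])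
  have gen: "Q \<subseteq> gen_submonoid G Q"
    unfolding gen_submonoid_def by (rule hull_subset)
  have pow: "q [^] n \<in> gen_submonoid G Q" if "q \<in> Q" for q and n :: nat
    using that gen by (induction n) auto
  have "finprod G (\<lambda>q. q [^] c q) F \<in> gen_submonoid G Q" if "finite F" "F \<subseteq> Q" for F and c :: "'a \<Rightarrow> nat"
    using that
  proof (induction F)
    case (insert q F)
    then show ?case using Q pow by (subst finprod_insert) auto
  qed simp
  then show "?L \<subseteq> gen_submonoid G Q"
    by (auto simp: lin_comb_def)
qed

section \<open>Divisibility of powers in a root-closed monoid\<close>

lemma quotient_group_pow:
  assumes "a \<in> carrier G" "b \<in> carrier G"
  shows "(diff_rel G `` {(a, b)}) [^]\<^bsub>quotient_group G\<^esub> (n::nat) = diff_rel G `` {(a [^] n, b [^] n)}"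
proof (induction n)
  case 0
  show ?case by (simp add: quotient_group_def)
next
  case (Suc n)
  then show ?case using assms by (simp add: quotient_group_mult)
qed

lemma root_closed_divides:
  assumes "root_closed G" and car: "x \<in> carrier G" "a \<in> carrier G" "w \<in> carrier G"
    and "n > 0" and eq: "x [^] (n::nat) = a [^] n \<otimes> w"
  obtains y where "y \<in> carrier G" "x = a \<otimes> y"
proof -
  \<comment> \<open>The formal difference of \<open>x\<close> and \<open>a\<close> is an \<open>n\<close>-th root of the monoid element \<open>w\<close>.\<close>
  let ?z = "diff_rel G `` {(x, a)}"
  have "?z [^]\<^bsub>quotient_group G\<^esub> n = quotient_embed G w"
    using car eq by (simp add: quotient_group_pow quotient_embed_def diff_rel_class_eq m_comm)
  then have "?z \<in> quotient_embed G ` carrier G"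
    using assms(1) car \<open>n > 0\<close> quotient_group_carrierI[of x a] unfolding root_closed_def by auto
  then obtain y where "y \<in> carrier G" "?z = quotient_embed G y"
    by auto
  then show thesis
    using that car by (simp add: quotient_embed_def diff_rel_class_eq m_comm)
qed

end

section \<open>The decomposition along the Apery set\<close>

locale root_closed_inside_factorial = comm_monoid_cancel G for G (structure) +
  fixes Q
  assumes root_closed: "root_closed G"
    and inside_factorial: "inside_factorial G Q"
begin

lemma base_closed: "Q \<subseteq> carrier G"
  using inside_factorial by (auto simp: inside_factorial_def)

lemma pow_lin_comb:
  assumes "x \<in> carrier G"
  obtains n :: nat and c where "n > 0" "finite_support Q c" "x [^] n = lin_comb G Q c"
proof -
  obtain n :: nat where n: "n > 0" "x [^] n \<in> gen_submonoid G Q"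
    using inside_factorial assms unfolding inside_factorial_def by metis
  then show thesis
    using that gen_submonoid_eq[OF base_closed] by auto
qed

lemma lin_comb_inj:
  assumes "finite_support Q c" "finite_support Q d" "lin_comb G Q c = lin_comb G Q d" "q \<in> Q"
  shows "c q = d q"
  using inside_factorial assms unfolding inside_factorial_def by blast

text \<open>
  This is \<open>v\<^sub>q(x \<otimes> y) = v\<^sub>q(x) + v\<^sub>q(y)\<close> with the denominators \<open>k\<close>, \<open>m\<close>, \<open>n\<close> cleared: both sides are
  exponents of \<open>q\<close> in the power \<open>(x \<otimes> y) [^] (k * m * n)\<close>.
\<close>

lemma coeff_mult:
  assumes car: "x \<in> carrier G" "y \<in> carrier G"
    and fin: "finite_support Q a" "finite_support Q b" "finite_support Q c"
    and x: "x [^] k = lin_comb G Q a" and y: "y [^] m = lin_comb G Q b"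
    and xy: "(x \<otimes> y) [^] n = lin_comb G Q c"
    and q: "q \<in> Q"
  shows "k * m * c q = n * m * a q + n * k * (b q :: nat)"
proof -
  have sup: "finite_support Q (\<lambda>q. k * m * c q)"
      "finite_support Q (\<lambda>q. n * m * a q)" "finite_support Q (\<lambda>q. n * k * b q)"
    by (rule finite_support_vanish[OF fin(3)] finite_support_vanish[OF fin(1)]
        finite_support_vanish[OF fin(2)]; simp)+
  have "lin_comb G Q (\<lambda>q. k * m * c q) = ((x \<otimes> y) [^] n) [^] (k * m)"
    using lin_comb_mult[OF base_closed fin(3)] xy by simp
  also have "\<dots> = (x [^] k) [^] (n * m) \<otimes> (y [^] m) [^] (n * k)"
    using car by (simp add: nat_pow_pow nat_pow_distrib ac_simps)
  also have "\<dots> = lin_comb G Q (\<lambda>q. n * m * a q + n * k * b q)"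
    using lin_comb_mult[OF base_closed] lin_comb_add[OF base_closed sup(2,3)] fin x y by simp
  finally show ?thesis
    using lin_comb_inj[OF sup(1) finite_support_add[OF sup(2,3)] _ q] by simp
qed

text \<open>
  An element fails to be in the Apery set exactly when some \<open>q\<close> divides it. By additivity of the
  coefficients a divisor \<open>q\<close> contributes \<open>n\<close> to \<open>c q\<close>; conversely, if \<open>c q \<ge> n\<close> then \<open>q [^] n\<close>
  divides \<open>x [^] n\<close>, and \<open>q\<close> divides \<open>x\<close> by root-closedness.
\<close>

lemma Ap_iff_coeff_less:
  assumes x: "x \<in> carrier G" and n: "n > (0::nat)" and fin: "finite_support Q c"
    and xn: "x [^] n = lin_comb G Q c"
  shows "x \<in> Ap G Q \<longleftrightarrow> (\<forall>q\<in>Q. c q < n)"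
proof
  assume Ap: "x \<in> Ap G Q"
  show "\<forall>q\<in>Q. c q < n"
  proof (rule ballI, rule ccontr)
    fix q assume q: "q \<in> Q" and "\<not> c q < n"
    define e where "e r = (if r = q then n else 0)" for r
    have fe: "finite_support Q e"
      unfolding e_def by (rule finite_support_single)
    have fd: "finite_support Q (\<lambda>r. c r - e r)"
      by (rule finite_support_vanish[OF fin]) simp
    have "lin_comb G Q c = lin_comb G Q (\<lambda>r. e r + (c r - e r))"
      by (rule lin_comb_cong[OF _ base_closed]) (use \<open>\<not> c q < n\<close> in \<open>auto simp: e_def\<close>)
    also have "\<dots> = q [^] n \<otimes> lin_comb G Q (\<lambda>r. c r - e r)"
      using lin_comb_add[OF base_closed fe fd] lin_comb_single[OF base_closed q, of n]
      by (simp add: e_def)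
    finally have "x [^] n = q [^] n \<otimes> lin_comb G Q (\<lambda>r. c r - e r)"
      using xn by simp
    then obtain y where "y \<in> carrier G" "x = q \<otimes> y"
      using root_closed_divides[OF root_closed x _ lin_comb_closed[OF base_closed] n] q base_closed
      by blast
    then show False
      using Ap q by (auto simp: Ap_def set_mult_def)
  qed
next
  assume less: "\<forall>q\<in>Q. c q < n"
  show "x \<in> Ap G Q"
  proof (rule ccontr)
    assume "x \<notin> Ap G Q"
    then obtain q y where q: "q \<in> Q" and y: "y \<in> carrier G" and eq: "x = q \<otimes> y"
      using x by (auto simp: Ap_def set_mult_def)
    obtain m :: nat and b where m: "m > 0" and b: "finite_support Q b" "y [^] m = lin_comb G Q b"
      using y by (rule pow_lin_comb)
    have "m * c q = n * m + n * b q"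
      using coeff_mult[OF _ y finite_support_single b(1) fin _ b(2) _ q, of q 1 q 1 n]
        lin_comb_single[OF base_closed q, of 1] q base_closed xn eq
      by auto
    then have "m * n \<le> m * c q"
      by (simp add: mult.commute)
    then have "n \<le> c q"
      using m by simp
    with less q show False
      using leD by blast
  qed
qed

lemma one_in_Ap: "\<one> \<in> Ap G Q"
  by (subst Ap_iff_coeff_less[where n = 1 and c = "\<lambda>q. 0"]) (auto simp: lin_comb_zero)

lemma Ap_subset: "Ap G Q \<subseteq> carrier G"
  by (auto simp: Ap_def)

interpretation gen: submonoid "gen_submonoid G Q" G
  by (rule submonoid_gen_submonoid[OF monoid_axioms base_closed])

text \<open>
  The quotients \<open>c q div n\<close> are the exponents of the generated part, and the remainders \<open>c q mod n\<close>
  are the coefficients of the \<open>n\<close>-th power of the cofactor.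
\<close>

lemma Ap_decomposition_exists:
  assumes x: "x \<in> carrier G"
  obtains a f where "a \<in> Ap G Q" "f \<in> gen_submonoid G Q" "x = a \<otimes> f"
proof -
  obtain n :: nat and c where n: "n > 0" and c: "finite_support Q c" and xn: "x [^] n = lin_comb G Q c"
    using x by (rule pow_lin_comb)
  let ?f = "lin_comb G Q (\<lambda>q. c q div n)" and ?w = "lin_comb G Q (\<lambda>q. c q mod n)"
  have fin: "finite_support Q (\<lambda>q. c q div n)" "finite_support Q (\<lambda>q. c q mod n)"
      "finite_support Q (\<lambda>q. n * (c q div n))"
    by (rule finite_support_vanish[OF c]; simp)+
  have car: "?f \<in> carrier G" "?w \<in> carrier G"
    by (rule lin_comb_closed[OF base_closed])+
  have split: "x [^] n = ?f [^] n \<otimes> ?w"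
    using lin_comb_add[OF base_closed fin(3,2)] lin_comb_mult[OF base_closed fin(1), of n] xn
    by simp
  then obtain y where y: "y \<in> carrier G" "x = ?f \<otimes> y"
    using root_closed_divides[OF root_closed x car n] by blast
  have "?f [^] n \<otimes> y [^] n = ?f [^] n \<otimes> ?w"
    using split y car by (simp add: nat_pow_distrib)
  then have "y [^] n = ?w"
    by (rule l_cancel) (use y car in auto)
  then have "y \<in> Ap G Q"
    using n by (subst Ap_iff_coeff_less[OF y(1) n fin(2)]) auto
  moreover have "?f \<in> gen_submonoid G Q"
    using gen_submonoid_eq[OF base_closed] fin(1) by blast
  ultimately show thesis
    using that y car by (simp add: m_comm)
qed

text \<open>
  Read \<open>d / k = b / n + c\<close> with \<open>b / n < 1\<close>: the valuation of a product \<open>a \<otimes> f\<close> determines the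
  exponent \<open>c\<close> of its generated part.
\<close>

lemma div_eq_integral_part:
  fixes n d k b c :: nat
  assumes "n * d = k * (b + n * c)" "b < n" "k > 0"
  shows "d div k = c"
proof -
  have "d div k = (n * d) div (n * k)"
    using assms(2) by simp
  also have "\<dots> = (k * (b + n * c)) div (k * n)"
    by (simp only: assms(1) mult.commute[of n k])
  also have "\<dots> = (b + n * c) div n"
    using assms(3) by simp
  also have "\<dots> = c"
    using assms(2) by simp
  finally show ?thesis .
qed

lemma Ap_decomposition_unique:
  assumes a: "a \<in> Ap G Q" "a' \<in> Ap G Q"
    and f: "f \<in> gen_submonoid G Q" "f' \<in> gen_submonoid G Q"
    and eq: "a \<otimes> f = a' \<otimes> f'"
  shows "a = a' \<and> f = f'"
proof -
  have car: "a \<in> carrier G" "a' \<in> carrier G" "f \<in> carrier G" "f' \<in> carrier G"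
    using a f Ap_subset gen.subset by auto
  obtain c where c: "finite_support Q c" "f = lin_comb G Q c"
    using f(1) gen_submonoid_eq[OF base_closed] by auto
  obtain c' where c': "finite_support Q c'" "f' = lin_comb G Q c'"
    using f(2) gen_submonoid_eq[OF base_closed] by auto
  obtain n :: nat and b where n: "n > 0" and b: "finite_support Q b" "a [^] n = lin_comb G Q b"
    using car(1) by (rule pow_lin_comb)
  obtain n' :: nat and b' where n': "n' > 0" and b': "finite_support Q b'" "a' [^] n' = lin_comb G Q b'"
    using car(2) by (rule pow_lin_comb)
  obtain k :: nat and d where k: "k > 0" and d: "finite_support Q d" "(a \<otimes> f) [^] k = lin_comb G Q d"
    using m_closed[OF car(1,3)] by (rule pow_lin_comb)
  have "c q = c' q" if q: "q \<in> Q" for q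
  proof -
    have small: "b q < n" "b' q < n'"
      using Ap_iff_coeff_less car a n n' b b' q by blast+
    \<comment> \<open>Both exponents are the integral part of \<open>d q / k\<close>.\<close>
    have "n * d q = k * (b q + n * c q)"
      using coeff_mult[OF car(1,3) b(1) c(1) d(1) b(2) _ d(2) q, of 1] c car
      by (simp add: algebra_simps)
    then have 1: "d q div k = c q"
      using div_eq_integral_part n k small by blast
    have "n' * d q = k * (b' q + n' * c' q)"
      using coeff_mult[OF car(2,4) b'(1) c'(1) d(1) b'(2) _ _ q, of 1 k] c' car d(2) eq
      by (simp add: algebra_simps)
    then have "d q div k = c' q"
      using div_eq_integral_part n' k small by blast
    with 1 show ?thesis by simp
  qed
  then have "f = f'"
    using lin_comb_cong[OF _ base_closed] c(2) c'(2) by blast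
  then show ?thesis
    using r_cancel[of a f a'] eq car by simp
qed

section \<open>The isomorphism\<close>

lemma Ap_sum_Ap_I:
  assumes "a \<in> Ap G Q" "b \<in> Ap G Q"
  shows "Ap_sum G Q a b \<in> Ap G Q" "Ap_I G Q a b \<in> gen_submonoid G Q"
    "Ap_sum G Q a b \<otimes> Ap_I G Q a b = a \<otimes> b"
proof -
  have "a \<otimes> b \<in> carrier G"
    using assms Ap_subset by auto
  then obtain c f where cf: "c \<in> Ap G Q" "f \<in> gen_submonoid G Q" "a \<otimes> b = c \<otimes> f"
    by (rule Ap_decomposition_exists)
  have unique: "c' = c \<and> f' = f"
    if "c' \<in> Ap G Q" "f' \<in> gen_submonoid G Q" "a \<otimes> b = c' \<otimes> f'" for c' f'
    using Ap_decomposition_unique[OF that(1) cf(1) that(2) cf(2)] that(3) cf(3) by simp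
  have "Ap_sum G Q a b = c"
    unfolding Ap_sum_def
  proof (rule the_equality, goal_cases)
    case 1
    show ?case using cf by blast
  next
    case (2 z)
    then show ?case using unique by blast
  qed
  moreover have "Ap_I G Q a b = f"
    unfolding Ap_I_def
  proof (rule the_equality, goal_cases)
    case 1
    show ?case using cf by blast
  next
    case (2 z)
    then show ?case using unique by blast
  qed
  ultimately show "Ap_sum G Q a b \<in> Ap G Q" "Ap_I G Q a b \<in> gen_submonoid G Q"
      "Ap_sum G Q a b \<otimes> Ap_I G Q a b = a \<otimes> b"
    using cf by auto
qed

lemma Ap_product_mult_closed:
  assumes "x \<in> carrier (Ap_product G Q)" "y \<in> carrier (Ap_product G Q)"
  shows "x \<otimes>\<^bsub>Ap_product G Q\<^esub> y \<in> carrier (Ap_product G Q)"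
  using assms Ap_sum_Ap_I by (auto simp: Ap_product_def)

lemma Ap_product_iso: "(\<lambda>(a, f). a \<otimes> f) \<in> iso (Ap_product G Q) G"
proof (rule isoI)
  show "(\<lambda>(a, f). a \<otimes> f) \<in> hom (Ap_product G Q) G"
  proof (rule homI)
    fix x assume "x \<in> carrier (Ap_product G Q)"
    then show "(case x of (a, f) \<Rightarrow> a \<otimes> f) \<in> carrier G"
      using Ap_subset gen.subset by (auto simp: Ap_product_def)
  next
    fix x y assume "x \<in> carrier (Ap_product G Q)" "y \<in> carrier (Ap_product G Q)"
    then obtain a f b g where xy: "x = (a, f)" "y = (b, g)" and ab: "a \<in> Ap G Q" "b \<in> Ap G Q"
      and fg: "f \<in> gen_submonoid G Q" "g \<in> gen_submonoid G Q"
      by (auto simp: Ap_product_def)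
    let ?c = "Ap_sum G Q a b" and ?h = "Ap_I G Q a b"
    have car: "a \<in> carrier G" "b \<in> carrier G" "f \<in> carrier G" "g \<in> carrier G"
        "?c \<in> carrier G" "?h \<in> carrier G"
      using ab fg Ap_sum_Ap_I[OF ab] Ap_subset gen.subset by auto
    have "?c \<otimes> (f \<otimes> g \<otimes> ?h) = (?c \<otimes> ?h) \<otimes> (f \<otimes> g)"
      using car by (simp add: m_ac)
    also have "\<dots> = (a \<otimes> f) \<otimes> (b \<otimes> g)"
      unfolding Ap_sum_Ap_I(3)[OF ab] using car by (simp add: m_ac)
    finally show "(case x \<otimes>\<^bsub>Ap_product G Q\<^esub> y of (a, f) \<Rightarrow> a \<otimes> f) =
        (case x of (a, f) \<Rightarrow> a \<otimes> f) \<otimes> (case y of (a, f) \<Rightarrow> a \<otimes> f)"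
      by (simp add: xy Ap_product_def)
  qed
  show "bij_betw (\<lambda>(a, f). a \<otimes> f) (carrier (Ap_product G Q)) (carrier G)"
    unfolding bij_betw_def
  proof
    show "inj_on (\<lambda>(a, f). a \<otimes> f) (carrier (Ap_product G Q))"
      using Ap_decomposition_unique by (auto simp: inj_on_def Ap_product_def)
    show "(\<lambda>(a, f). a \<otimes> f) ` carrier (Ap_product G Q) = carrier G"
    proof
      show "(\<lambda>(a, f). a \<otimes> f) ` carrier (Ap_product G Q) \<subseteq> carrier G"
        using Ap_subset gen.subset by (auto simp: Ap_product_def)
      show "carrier G \<subseteq> (\<lambda>(a, f). a \<otimes> f) ` carrier (Ap_product G Q)"
      proof
        fix x assume "x \<in> carrier G"
        then obtain a f where "a \<in> Ap G Q" "f \<in> gen_submonoid G Q" "x = a \<otimes> f"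
          by (rule Ap_decomposition_exists)
        then show "x \<in> (\<lambda>(a, f). a \<otimes> f) ` carrier (Ap_product G Q)"
          by (auto simp: Ap_product_def image_iff)
      qed
    qed
  qed
qed

lemma Ap_product_one:
  "\<one>\<^bsub>Ap_product G Q\<^esub> \<in> carrier (Ap_product G Q)"
  "(\<lambda>(a, f). a \<otimes> f) \<one>\<^bsub>Ap_product G Q\<^esub> = \<one>"
  using one_in_Ap by (auto simp: Ap_product_def)

end

lemma inv_into_iso:
  assumes h: "h \<in> iso N M"
    and closed: "\<And>x y. x \<in> carrier N \<Longrightarrow> y \<in> carrier N \<Longrightarrow> x \<otimes>\<^bsub>N\<^esub> y \<in> carrier N"
  shows "inv_into (carrier N) h \<in> iso M N"
proof (rule isoI)
  have hom: "h \<in> hom N M" and bij: "bij_betw h (carrier N) (carrier M)"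
    using h by (auto simp: iso_def)
  let ?g = "inv_into (carrier N) h"
  show bij_inv: "bij_betw ?g (carrier M) (carrier N)"
    by (rule bij_betw_inv_into[OF bij])
  show "?g \<in> hom M N"
  proof (rule homI)
    show car: "?g x \<in> carrier N" if "x \<in> carrier M" for x
      using bij_betwE[OF bij_inv] that by blast
    fix x y assume xy: "x \<in> carrier M" "y \<in> carrier M"
    have "h (?g x \<otimes>\<^bsub>N\<^esub> ?g y) = x \<otimes>\<^bsub>M\<^esub> y"
      using hom_mult[OF hom car[OF xy(1)] car[OF xy(2)]] bij_betw_inv_into_right[OF bij] xy
      by simp
    then show "?g (x \<otimes>\<^bsub>M\<^esub> y) = ?g x \<otimes>\<^bsub>N\<^esub> ?g y"
      using bij_betw_inv_into_left[OF bij closed[OF car[OF xy(1)] car[OF xy(2)]]] by simp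
  qed
qed

text \<open>
  A multiplicative injection that preserves the neutral element reflects every equational law and
  every cancellation law.
\<close>

lemma comm_monoid_cancel_inj_hom:
  assumes "comm_monoid_cancel M" and h: "h \<in> hom N M" "inj_on h (carrier N)"
    and one: "\<one>\<^bsub>N\<^esub> \<in> carrier N" "h \<one>\<^bsub>N\<^esub> = \<one>\<^bsub>M\<^esub>"
    and closed: "\<And>x y. x \<in> carrier N \<Longrightarrow> y \<in> carrier N \<Longrightarrow> x \<otimes>\<^bsub>N\<^esub> y \<in> carrier N"
  shows "comm_monoid_cancel N"
proof -
  interpret M: comm_monoid_cancel M by fact
  have car: "h x \<in> carrier M" if "x \<in> carrier N" for x
    using h(1) that by (rule hom_in_carrier)
  have mult: "h (x \<otimes>\<^bsub>N\<^esub> y) = h x \<otimes>\<^bsub>M\<^esub> h y" if "x \<in> carrier N" "y \<in> carrier N" for x y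
    using h(1) that by (rule hom_mult)
  note inj = inj_onD[OF h(2)]
  interpret N: comm_monoid N
  proof (rule comm_monoidI)
    show "x \<otimes>\<^bsub>N\<^esub> y \<otimes>\<^bsub>N\<^esub> z = x \<otimes>\<^bsub>N\<^esub> (y \<otimes>\<^bsub>N\<^esub> z)"
      if "x \<in> carrier N" "y \<in> carrier N" "z \<in> carrier N" for x y z
      using that by (intro inj) (simp_all add: closed car mult M.m_assoc)
    show "\<one>\<^bsub>N\<^esub> \<otimes>\<^bsub>N\<^esub> x = x" if "x \<in> carrier N" for x
      using that by (intro inj) (simp_all add: closed car mult one)
    show "x \<otimes>\<^bsub>N\<^esub> y = y \<otimes>\<^bsub>N\<^esub> x" if "x \<in> carrier N" "y \<in> carrier N" for x y
      using that by (intro inj) (simp_all add: closed car mult M.m_comm)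
  qed (use closed one in auto)
  show ?thesis
  proof (rule comm_monoid_cancelI)
    fix a b c assume "a \<otimes>\<^bsub>N\<^esub> c = b \<otimes>\<^bsub>N\<^esub> c" "a \<in> carrier N" "b \<in> carrier N" "c \<in> carrier N"
    then show "a = b"
      using mult[of a c] mult[of b c] car M.r_cancel[of "h a" "h c" "h b"] by (intro inj) auto
  qed (rule N.comm_monoid_axioms)
qed

theorem theorem3:
  fixes M :: "('a, 'b) monoid_scheme" and Q :: "'a set"
  assumes "comm_monoid_cancel M"
    and "reduced M"
    and "root_closed M"
    and "cale_monoid M Q"
  shows "comm_monoid_cancel (Ap_product M Q) \<and> M \<cong> Ap_product M Q"
proof
  interpret M: comm_monoid_cancel M by fact
  interpret M: root_closed_inside_factorial M Q
    by unfold_locales (use assms in \<open>auto simp: cale_monoid_def\<close>)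
  let ?h = "\<lambda>(a, f). a \<otimes>\<^bsub>M\<^esub> f"
  have iso: "?h \<in> iso (Ap_product M Q) M"
    by (rule M.Ap_product_iso)
  show cancel: "comm_monoid_cancel (Ap_product M Q)"
    by (rule comm_monoid_cancel_inj_hom[of M ?h])
      (use assms(1) iso M.Ap_product_one M.Ap_product_mult_closed in
        \<open>auto simp: iso_def bij_betw_def\<close>)
  show "M \<cong> Ap_product M Q"
    using inv_into_iso[OF iso M.Ap_product_mult_closed] by (auto simp: is_iso_def)
qed

end
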